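(* Let $m\ge1$ be an integer and let $C=a\,C_a\oplus b\,C_b$ be an $H_{23}$-code of length $n=2m$, with binary component $C_a\subseteq\mathbb{F}_2^{n}$ and ternary component $C_b\subseteq\mathbb{F}_3^{n}$. Then $C$ is symplectic nice if and only if $C_b=\{\mathbf{0}\}$.
   Context: Ring: $H_{23}=\langle a,b\mid 2a=0,\ 3b=0,\ a^2=a,\ b^2=0,\ ab=ba=0\rangle$ is the commutative non-unital ring of order six with elements $0,a,b,a+b,2b,a+2b$. For $\mathbf{x}\in\mathbb{F}_2^n$, $a\mathbf{x}$ is the vector obtained coordinatewise from $a\cdot0=0$, $a\cdot1=a$; for $\mathbf{y}\in\mathbb{F}_3^n$, $b\mathbf{y}$ is obtained coordinatewise from $b\cdot0=0$, $b\cdot1=b$, $b\cdot2=2b$. Every vector of $H_{23}^n$ is uniquely $a\mathbf{x}+b\mathbf{y}$ with $\mathbf{x}\in\mathbb{F}_2^n$, $\mathbf{y}\in\mathbb{F}_3^n$. Codes: an $H_{23}$-code of length $n$ is an $H_{23}$-submodule $C\subseteq H_{23}^n$ (an additive subgroup closed under multiplication by elements of $H_{23}$). It decomposes as $C=aC_a\oplus bC_b=\{a\mathbf{u}+b\mathbf{v}: \mathbf{u}\in C_a,\mathbf{v}\in C_b\}$ with $C_a=\{\mathbf{u}\in\mathbb{F}_2^n: a\mathbf{u}\in C\}$ and $C_b=\{\mathbf{v}\in\mathbb{F}_3^n: b\mathbf{v}\in C\}$, which are linear codes over $\mathbb{F}_2$ and $\mathbb{F}_3$ respectively. Symplectic forms: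 for $\mathbf{x}=(\mathbf{x}_1\mid\mathbf{x}_2),\mathbf{y}=(\mathbf{y}_1\mid\mathbf{y}_2)\in\mathbb{F}_2^{2m}$ with $\mathbf{x}_i,\mathbf{y}_i\in\mathbb{F}_2^m$, set $\langle\mathbf{x},\mathbf{y}\rangle_s^{(\mathbb{F}_2)}=\mathbf{x}_1\cdot\mathbf{y}_2+\mathbf{x}_2\cdot\mathbf{y}_1$, where $\cdot$ is the usual dot product. For $\mathbf{c}=a\mathbf{x}+b\mathbf{y}$, $\mathbf{c}'=a\mathbf{x}'+b\mathbf{y}'$ in $H_{23}^{2m}$ (with $\mathbf{x},\mathbf{x}'\in\mathbb{F}_2^{2m}$, $\mathbf{y},\mathbf{y}'\in\mathbb{F}_3^{2m}$), set $\langle\mathbf{c},\mathbf{c}'\rangle_S=a\langle\mathbf{x},\mathbf{x}'\rangle_s^{(\mathbb{F}_2)}$ (the ternary part contributes $0$ because $b^2=0$). The symplectic dual of an $H_{23}$-code $C$ of length $2m$ is $C^{\perp_S}=\{\mathbf{y}\in H_{23}^{2m}:\langle\mathbf{y},\mathbf{c}\rangle_S=0\text{ for all }\mathbf{c}\in C\}$. $C$ is symplectic nice if $|C|\,|C^{\perp_S}|=36^m$. *)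

theory Defs
  imports "HOL-Library.Numeral_Type" "Jordan_Normal_Form.Matrix"
begin

text \<open>The numeral types \<^typ>\<open>2\<close> and \<^typ>\<open>3\<close>, with their arithmetic modulo 2 and 3, serve as
  the prime fields of order 2 and 3.\<close>

lemma UNIV_2: "(UNIV :: 2 set) = {0, 1}"
proof -
  have "card {0, 1 :: 2} = CARD(2)" by simp
  then show ?thesis by (metis card_subset_eq finite subset_UNIV)
qed

lemma UNIV_3: "(UNIV :: 3 set) = {0, 1, 2}"
proof -
  have "card {0, 1, 2 :: 3} = CARD(3)" by simp
  then show ?thesis by (metis card_subset_eq finite subset_UNIV)
qed

lemma unit_2: "x \<noteq> 0 \<Longrightarrow> x * x = 1" for x :: 2
proof -
  assume "x \<noteq> 0"
  moreover have "x \<in> {0, 1}" using UNIV_2 by blast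
  ultimately show ?thesis by auto
qed

lemma unit_3: "x \<noteq> 0 \<Longrightarrow> x * x = 1" for x :: 3
proof -
  assume "x \<noteq> 0"
  moreover have "x \<in> {0, 1, 2}" using UNIV_3 by blast
  ultimately show ?thesis by auto
qed


text \<open>\<open>H23 s t\<close> is the element \<open>a s + b t\<close> of the ring. The product
  \<open>(a s + b t) (a s' + b t') = a s s'\<close> is forced by \<open>a\<^sup>2 = a\<close>, \<open>b\<^sup>2 = 0\<close> and \<open>a b = b a = 0\<close>.
  The class \<^class>\<open>comm_ring\<close> does not require a unit.\<close>

datatype H23 = H23 (bin_part: "2") (ter_part: "3")

instantiation H23 :: comm_ring
begin

definition zero_H23 :: H23 where "0 = H23 0 0"
definition plus_H23 :: "H23 \<Rightarrow> H23 \<Rightarrow> H23" where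
  "x + y = H23 (bin_part x + bin_part y) (ter_part x + ter_part y)"
definition uminus_H23 :: "H23 \<Rightarrow> H23" where
  "- x = H23 (- bin_part x) (- ter_part x)"
definition minus_H23 :: "H23 \<Rightarrow> H23 \<Rightarrow> H23" where
  "x - y = H23 (bin_part x - bin_part y) (ter_part x - ter_part y)"
definition times_H23 :: "H23 \<Rightarrow> H23 \<Rightarrow> H23" where
  "x * y = H23 (bin_part x * bin_part y) 0"

instance
  by standard (auto simp: zero_H23_def plus_H23_def uminus_H23_def minus_H23_def times_H23_def
      algebra_simps)

end

definition gen_a :: H23 where "gen_a = H23 1 0"
definition gen_b :: H23 where "gen_b = H23 0 1"

definition a_times :: "2 \<Rightarrow> H23" where "a_times s = H23 s 0"
definition b_times :: "3 \<Rightarrow> H23" where "b_times t = H23 0 t"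

lemma H23_relations:
  "gen_a + gen_a = 0" "gen_b + gen_b + gen_b = 0"
  "gen_a * gen_a = gen_a" "gen_b * gen_b = 0" "gen_a * gen_b = 0" "gen_b * gen_a = 0"
  by (simp_all add: gen_a_def gen_b_def zero_H23_def plus_H23_def times_H23_def)

lemma a_times_simps: "a_times 0 = 0" "a_times 1 = gen_a"
  by (simp_all add: a_times_def gen_a_def zero_H23_def)

lemma b_times_simps: "b_times 0 = 0" "b_times 1 = gen_b" "b_times 2 = gen_b + gen_b"
  by (simp_all add: b_times_def gen_b_def zero_H23_def plus_H23_def)

lemma H23_decomp: "x = a_times (bin_part x) + b_times (ter_part x)"
  by (simp add: a_times_def b_times_def plus_H23_def)

lemma UNIV_H23:
  "(UNIV :: H23 set) =
    {0, gen_a, gen_b, gen_a + gen_b, gen_b + gen_b, gen_a + (gen_b + gen_b)}"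
proof -
  have "x \<in> {0, gen_a, gen_b, gen_a + gen_b, gen_b + gen_b, gen_a + (gen_b + gen_b)}" for x
  proof (cases x)
    case (H23 s t)
    have "s \<in> {0, 1}" "t \<in> {0, 1, 2}"
      using UNIV_2 UNIV_3 by blast+
    then show ?thesis
      by (auto simp: H23 gen_a_def gen_b_def zero_H23_def plus_H23_def)
  qed
  then show ?thesis by blast
qed

lemma card_H23: "CARD(H23) = 6"
  by (simp add: UNIV_H23 gen_a_def gen_b_def zero_H23_def plus_H23_def)


definition H23_code :: "nat \<Rightarrow> H23 vec set \<Rightarrow> bool" where
  "H23_code n C \<longleftrightarrow>
     C \<subseteq> carrier_vec n \<and> 0\<^sub>v n \<in> C \<and> (\<forall>x\<in>C. \<forall>y\<in>C. x + y \<in> C) \<and> (\<forall>x\<in>C. - x \<in> C) \<and>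
     (\<forall>r. \<forall>x\<in>C. r \<cdot>\<^sub>v x \<in> C)"

definition bin_component :: "nat \<Rightarrow> H23 vec set \<Rightarrow> 2 vec set" where
  "bin_component n C = {u \<in> carrier_vec n. map_vec a_times u \<in> C}"

definition ter_component :: "nat \<Rightarrow> H23 vec set \<Rightarrow> 3 vec set" where
  "ter_component n C = {v \<in> carrier_vec n. map_vec b_times v \<in> C}"

lemma vec_decomp: "x = map_vec a_times (map_vec bin_part x) + map_vec b_times (map_vec ter_part x)"
  by (rule eq_vecI) (auto intro: H23_decomp)

lemma H23_code_decomp:
  assumes "H23_code n C"
  shows "C = {map_vec a_times u + map_vec b_times v | u v.
                u \<in> bin_component n C \<and> v \<in> ter_component n C}" (is "_ = ?D")
proof
  show "?D \<subseteq> C"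
    using assms by (auto simp: H23_code_def bin_component_def ter_component_def)
next
  show "C \<subseteq> ?D"
  proof
    fix x assume x: "x \<in> C"
    let ?u = "map_vec bin_part x" and ?v = "map_vec ter_part x"
    have dim: "x \<in> carrier_vec n" using assms x by (auto simp: H23_code_def)
    have "gen_a \<cdot>\<^sub>v x \<in> C" using assms x by (auto simp: H23_code_def)
    moreover have "gen_a \<cdot>\<^sub>v x = map_vec a_times ?u"
      by (rule eq_vecI) (auto simp: gen_a_def a_times_def times_H23_def)
    ultimately have u: "map_vec a_times ?u \<in> C" by simp
    have "x + - map_vec a_times ?u \<in> C"
      using assms x u by (auto simp: H23_code_def)
    moreover have "x + - map_vec a_times ?u = map_vec b_times ?v"
      by (rule eq_vecI)
        (auto simp: a_times_def b_times_def plus_H23_def uminus_H23_def)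
    ultimately have v: "map_vec b_times ?v \<in> C" by simp
    have "?u \<in> bin_component n C" "?v \<in> ter_component n C"
      using u v dim by (auto simp: bin_component_def ter_component_def)
    then show "x \<in> ?D"
      using vec_decomp[of x] by blast
  qed
qed

definition symp_form_F2 :: "nat \<Rightarrow> 2 vec \<Rightarrow> 2 vec \<Rightarrow> 2" where
  "symp_form_F2 m x y = vec_first x m \<bullet> vec_last y m + vec_last x m \<bullet> vec_first y m"

text \<open>The ternary parts do not contribute, since \<open>b\<^sup>2 = 0\<close>.\<close>

definition symp_form :: "nat \<Rightarrow> H23 vec \<Rightarrow> H23 vec \<Rightarrow> H23" where
  "symp_form m c c' = a_times (symp_form_F2 m (map_vec bin_part c) (map_vec bin_part c'))"

definition symp_dual :: "nat \<Rightarrow> H23 vec set \<Rightarrow> H23 vec set" where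
  "symp_dual m C = {y \<in> carrier_vec (2 * m). \<forall>c\<in>C. symp_form m y c = 0}"

definition symp_nice :: "nat \<Rightarrow> H23 vec set \<Rightarrow> bool" where
  "symp_nice m C \<longleftrightarrow> card C * card (symp_dual m C) = 36 ^ m"

end

theory Submission
  imports Defs
begin

text \<open>Sorting coordinates into binary and ternary parts gives \<open>|C| = |C\<^sub>a| |C\<^sub>b|\<close> and
  \<open>|C\<^sup>\<bottom>| = |C\<^sub>a\<^sup>\<bottom>| 9\<^sup>m\<close>, because the form ignores the ternary part. Summing the signs
  \<open>(-1)\<^bsup>\<langle>x,c\<rangle>\<^esup>\<close> over \<open>x \<in> \<bbbF>\<^sub>2\<^bsup>2m\<^esup>\<close> and \<open>c \<in> C\<^sub>a\<close> in both orders gives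
  \<open>|C\<^sub>a| |C\<^sub>a\<^sup>\<bottom>| = 4\<^sup>m\<close>, so \<open>|C| |C\<^sup>\<bottom>| = 36\<^sup>m |C\<^sub>b|\<close>.\<close>

section \<open>Counting vectors over a finite type\<close>

lemma card_carrier_vec:
  "card (carrier_vec n :: 'a::finite vec set) = CARD('a) ^ n"
proof -
  have "bij_betw list_of_vec (carrier_vec n :: 'a vec set) {xs. set xs \<subseteq> UNIV \<and> length xs = n}"
  proof (rule bij_betw_byWitness[where f' = vec_of_list])
    show "\<forall>v\<in>carrier_vec n. vec_of_list (list_of_vec v) = (v :: 'a vec)"
      by (simp add: vec_list)
    show "\<forall>xs\<in>{xs. set xs \<subseteq> UNIV \<and> length xs = n}.
        list_of_vec (vec_of_list xs) = (xs :: 'a list)"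
      by (simp add: list_vec)
    show "list_of_vec ` (carrier_vec n :: 'a vec set) \<subseteq> {xs. set xs \<subseteq> UNIV \<and> length xs = n}"
      by (auto dest: carrier_vecD)
    show "vec_of_list ` {xs :: 'a list. set xs \<subseteq> UNIV \<and> length xs = n} \<subseteq> carrier_vec n"
      by (auto intro: carrier_vecI)
  qed
  from bij_betw_same_card[OF this] show ?thesis
    by (simp only: card_lists_length_eq finite)
qed

text \<open>An infinite set has \<open>card\<close> 0, so the positive cardinality just computed
  forces finiteness.\<close>

lemma finite_carrier_vec: "finite (carrier_vec n :: 'a::finite vec set)"
  by (rule card_ge_0_finite) (simp add: card_carrier_vec)

section \<open>Sign sums over sets of binary vectors\<close>

lemma cases_2: "x = 0 \<or> x = 1" for x :: 2
  using UNIV_2 by blast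

text \<open>The nontrivial additive character of the field of order 2. Integer values let its sums
  count elements.\<close>

definition sign_2 :: "2 \<Rightarrow> int" where
  "sign_2 s = (if s = 0 then 1 else - 1)"

lemma sign_2_add: "sign_2 (s + t) = sign_2 s * sign_2 t"
  using cases_2[of s] cases_2[of t] by (auto simp: sign_2_def)

text \<open>Orthogonality of characters: if \<open>f g \<noteq> 0\<close> for some \<open>g\<close>
  in \<open>G\<close>, translation by \<open>g\<close> permutes \<open>G\<close> and flips every
  sign, so the sum equals its own negative.\<close>

lemma sum_sign_2_additive:
  fixes f :: "2 vec \<Rightarrow> 2"
  assumes G: "G \<subseteq> carrier_vec n" and closed: "\<And>x y. x \<in> G \<Longrightarrow> y \<in> G \<Longrightarrow> x + y \<in> G"
    and add: "\<And>x y. x \<in> G \<Longrightarrow> y \<in> G \<Longrightarrow> f (x + y) = f x + f y"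
  shows "(\<Sum>x\<in>G. sign_2 (f x)) = (if \<forall>x\<in>G. f x = 0 then int (card G) else 0)"
proof (cases "\<forall>x\<in>G. f x = 0")
  case True
  then show ?thesis by (simp add: sign_2_def)
next
  case False
  then obtain g where g: "g \<in> G" "f g \<noteq> 0" by blast
  \<comment> \<open>In characteristic 2 translation by \<open>g\<close> is an involution, so it is
    its own inverse in the reindexing below.\<close>
  have cancel: "x + g + g = x" if "x \<in> G" for x
  proof -
    have dims: "dim_vec x = n" "dim_vec g = n" using G that g by (auto dest: carrier_vecD)
    have "s + t + t = s" for s t :: 2
      using cases_2[of s] cases_2[of t] by auto
    then show ?thesis by (intro eq_vecI) (simp_all add: dims)
  qed
  have sign_g: "sign_2 (f g) = - 1" using g by (simp add: sign_2_def)
  have "(\<Sum>x\<in>G. sign_2 (f x)) = (\<Sum>x\<in>G. sign_2 (f (x + g)))"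
    by (rule sum.reindex_bij_witness[where i = "\<lambda>x. x + g" and j = "\<lambda>x. x + g"])
      (auto simp: cancel closed g)
  also have "\<dots> = - (\<Sum>x\<in>G. sign_2 (f x))"
    by (simp add: add g sign_2_add sign_g sum_negf)
  finally have "(\<Sum>x\<in>G. sign_2 (f x)) = 0" by simp
  then show ?thesis using False by auto
qed

section \<open>The binary symplectic form and its duals\<close>

lemma symp_form_F2_sum:
  assumes "x \<in> carrier_vec (2 * m)" "y \<in> carrier_vec (2 * m)"
  shows "symp_form_F2 m x y = (\<Sum>i<m. x $ i * y $ (m + i) + x $ (m + i) * y $ i)"
  using assms
  by (simp add: symp_form_F2_def scalar_prod_def vec_first_def vec_last_def sum.distrib
      atLeast0LessThan)

lemma symp_form_F2_add_left:
  assumes "x \<in> carrier_vec (2 * m)" "x' \<in> carrier_vec (2 * m)" "y \<in> carrier_vec (2 * m)"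
  shows "symp_form_F2 m (x + x') y = symp_form_F2 m x y + symp_form_F2 m x' y"
proof -
  have "x + x' \<in> carrier_vec (2 * m)" using assms by simp
  then show ?thesis
    using assms
    by (simp add: symp_form_F2_sum sum.distrib[symmetric])
      (rule sum.cong, auto simp: algebra_simps)
qed

lemma symp_form_F2_commute:
  assumes "x \<in> carrier_vec (2 * m)" "y \<in> carrier_vec (2 * m)"
  shows "symp_form_F2 m x y = symp_form_F2 m y x"
  using assms by (simp add: symp_form_F2_sum algebra_simps)

text \<open>The form exchanges the two halves: the unit vector at \<open>m + i\<close> reads off
  coordinate \<open>i\<close> of \<open>y\<close>, and the one at \<open>i\<close> reads off
  coordinate \<open>m + i\<close>.\<close>

lemma symp_form_F2_nondegenerate:
  assumes y: "y \<in> carrier_vec (2 * m)"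
  shows "(\<forall>x\<in>carrier_vec (2 * m). symp_form_F2 m x y = 0) \<longleftrightarrow> y = 0\<^sub>v (2 * m)"
proof
  assume *: "\<forall>x\<in>carrier_vec (2 * m). symp_form_F2 m x y = 0"
  have low: "y $ i = 0" if "i < m" for i
  proof -
    have "symp_form_F2 m (unit_vec (2 * m) (m + i)) y = (\<Sum>j<m. if j = i then y $ j else 0)"
      unfolding symp_form_F2_sum[OF unit_vec_carrier y]
      by (rule sum.cong) (use that in auto)
    then show ?thesis using * that by simp
  qed
  have high: "y $ (m + i) = 0" if "i < m" for i
  proof -
    have "symp_form_F2 m (unit_vec (2 * m) i) y = (\<Sum>j<m. if j = i then y $ (m + j) else 0)"
      unfolding symp_form_F2_sum[OF unit_vec_carrier y]
      by (rule sum.cong) (use that in auto)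
    then show ?thesis using * that by simp
  qed
  show "y = 0\<^sub>v (2 * m)"
  proof (rule eq_vecI)
    fix i assume i: "i < dim_vec (0\<^sub>v (2 * m) :: 2 vec)"
    then show "y $ i = 0\<^sub>v (2 * m) $ i"
      using low[of i] high[of "i - m"] by (cases "i < m") auto
  qed (use y in auto)
qed (auto simp: symp_form_F2_sum)

definition symp_dual_F2 :: "nat \<Rightarrow> 2 vec set \<Rightarrow> 2 vec set" where
  "symp_dual_F2 m A = {x \<in> carrier_vec (2 * m). \<forall>c\<in>A. symp_form_F2 m x c = 0}"

lemma card_symp_dual_F2:
  assumes A: "A \<subseteq> carrier_vec (2 * m)" and zero: "0\<^sub>v (2 * m) \<in> A"
    and closed: "\<And>x y. x \<in> A \<Longrightarrow> y \<in> A \<Longrightarrow> x + y \<in> A"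
  shows "card A * card (symp_dual_F2 m A) = 4 ^ m"
proof -
  let ?V = "carrier_vec (2 * m) :: 2 vec set"
  have finA: "finite A" using A finite_carrier_vec finite_subset by blast
  have A_in: "c \<in> ?V" if "c \<in> A" for c using A that by blast
  \<comment> \<open>Row sums: for fixed \<open>x\<close> the signs over \<open>A\<close> add up to
    \<open>card A\<close> if \<open>x\<close> is orthogonal to all of \<open>A\<close>, and cancel
    otherwise.\<close>
  have "(\<Sum>x\<in>?V. \<Sum>c\<in>A. sign_2 (symp_form_F2 m x c)) =
      (\<Sum>x\<in>?V. if x \<in> symp_dual_F2 m A then int (card A) else 0)"
  proof (rule sum.cong)
    fix x assume x: "x \<in> ?V"
    \<comment> \<open>Symmetry carries additivity over from the first argument to the
      second.\<close>
    have "symp_form_F2 m x (c + c') = symp_form_F2 m x c + symp_form_F2 m x c'"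
      if "c \<in> A" "c' \<in> A" for c c'
      using that x A_in closed
      by (simp add: symp_form_F2_commute[of x] symp_form_F2_add_left)
    then show "(\<Sum>c\<in>A. sign_2 (symp_form_F2 m x c)) =
        (if x \<in> symp_dual_F2 m A then int (card A) else 0)"
      using sum_sign_2_additive[OF A closed, of "symp_form_F2 m x"] x
      by (simp add: symp_dual_F2_def)
  qed simp
  also have "\<dots> = int (card A * card (symp_dual_F2 m A))"
  proof -
    have "?V \<inter> symp_dual_F2 m A = symp_dual_F2 m A" by (auto simp: symp_dual_F2_def)
    then show ?thesis
      by (simp add: sum.inter_restrict[OF finite_carrier_vec, symmetric])
  qed
  finally have rows: "(\<Sum>x\<in>?V. \<Sum>c\<in>A. sign_2 (symp_form_F2 m x c)) =
      int (card A * card (symp_dual_F2 m A))" .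
  \<comment> \<open>Column sums: by nondegeneracy only the column of the zero vector survives, and
    it contributes \<open>2 ^ (2 * m) = 4 ^ m\<close>.\<close>
  have "(\<Sum>c\<in>A. \<Sum>x\<in>?V. sign_2 (symp_form_F2 m x c)) =
      (\<Sum>c\<in>A. if c = 0\<^sub>v (2 * m) then int (card ?V) else 0)"
  proof (rule sum.cong)
    fix c assume "c \<in> A"
    then have c: "c \<in> ?V" by (rule A_in)
    show "(\<Sum>x\<in>?V. sign_2 (symp_form_F2 m x c)) =
        (if c = 0\<^sub>v (2 * m) then int (card ?V) else 0)"
      using sum_sign_2_additive[of ?V "2 * m" "\<lambda>x. symp_form_F2 m x c"] c
      by (simp add: symp_form_F2_add_left symp_form_F2_nondegenerate)
  qed simp
  also have "\<dots> = int (4 ^ m)"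
    using finA zero by (simp add: card_carrier_vec power_mult)
  finally have "int (card A * card (symp_dual_F2 m A)) = int (4 ^ m)"
    using rows by (simp only: sum.swap[of _ A])
  then show ?thesis by (simp only: of_nat_eq_iff)
qed

section \<open>Splitting codes and their duals into binary and ternary parts\<close>

lemma bin_part_a_b:
  assumes "u \<in> carrier_vec n" "v \<in> carrier_vec n"
  shows "map_vec bin_part (map_vec a_times u + map_vec b_times v) = u"
  using assms by (auto simp: a_times_def b_times_def plus_H23_def)

lemma ter_part_a_b:
  assumes "u \<in> carrier_vec n" "v \<in> carrier_vec n"
  shows "map_vec ter_part (map_vec a_times u + map_vec b_times v) = v"
  using assms by (auto simp: a_times_def b_times_def plus_H23_def)

text \<open>The two coordinate projections recover \<open>u\<close> and \<open>v\<close> from the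
  sum, so distinct pairs give distinct vectors.\<close>

lemma card_a_plus_b:
  assumes "A \<subseteq> carrier_vec n" "B \<subseteq> carrier_vec n"
  shows "card {map_vec a_times u + map_vec b_times v | u v. u \<in> A \<and> v \<in> B} = card A * card B"
    (is "card ?D = _")
proof -
  have inj: "inj_on (\<lambda>(u, v). map_vec a_times u + map_vec b_times v) (A \<times> B)"
  proof (rule inj_on_inverseI[where g = "\<lambda>x. (map_vec bin_part x, map_vec ter_part x)"], clarify)
    fix u v assume "u \<in> A" "v \<in> B"
    then have "u \<in> carrier_vec n" "v \<in> carrier_vec n" using assms by blast+
    then show "map_vec bin_part (map_vec a_times u + map_vec b_times v) = u \<and>
        map_vec ter_part (map_vec a_times u + map_vec b_times v) = v"
      by (simp only: bin_part_a_b[of _ n] ter_part_a_b[of _ n] simp_thms)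
  qed
  have "?D = (\<lambda>(u, v). map_vec a_times u + map_vec b_times v) ` (A \<times> B)"
    by force
  then show ?thesis
    by (simp only: card_image[OF inj] card_cartesian_product)
qed

lemma symp_dual_decomp:
  assumes C: "H23_code (2 * m) C"
  shows "symp_dual m C = {map_vec a_times u + map_vec b_times v | u v.
    u \<in> symp_dual_F2 m (bin_component (2 * m) C) \<and> v \<in> carrier_vec (2 * m)}" (is "_ = ?D")
proof -
  \<comment> \<open>The form sees the projections of codewords, whereas \<open>bin_component\<close>
    asks that \<open>a u\<close> itself lie in \<open>C\<close>. The decomposition of
    \<open>C\<close> makes the two sets agree.\<close>
  have bins: "map_vec bin_part ` C = bin_component (2 * m) C"
  proof
    show "map_vec bin_part ` C \<subseteq> bin_component (2 * m) C"
      by (subst (1) H23_code_decomp[OF C])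
        (auto simp: bin_component_def ter_component_def bin_part_a_b[of _ "2 * m"])
    show "bin_component (2 * m) C \<subseteq> map_vec bin_part ` C"
    proof
      fix u assume u: "u \<in> bin_component (2 * m) C"
      have "map_vec bin_part (map_vec a_times u) = u"
        by (rule eq_vecI) (auto simp: a_times_def)
      then show "u \<in> map_vec bin_part ` C"
        using u unfolding bin_component_def by (metis (mono_tags, lifting) imageI mem_Collect_eq)
    qed
  qed
  have dual: "x \<in> symp_dual m C \<longleftrightarrow> x \<in> carrier_vec (2 * m) \<and>
      map_vec bin_part x \<in> symp_dual_F2 m (bin_component (2 * m) C)" for x
    unfolding bins[symmetric]
    by (auto simp: symp_dual_def symp_dual_F2_def symp_form_def a_times_def zero_H23_def)
  show ?thesis
  proof
    show "symp_dual m C \<subseteq> ?D"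
    proof
      fix x assume "x \<in> symp_dual m C"
      then have "map_vec bin_part x \<in> symp_dual_F2 m (bin_component (2 * m) C)"
        "map_vec ter_part x \<in> carrier_vec (2 * m)"
        by (auto simp: dual)
      then show "x \<in> ?D" using vec_decomp[of x] by blast
    qed
    show "?D \<subseteq> symp_dual m C"
      by (auto simp: dual symp_dual_F2_def bin_part_a_b[of _ "2 * m"])
  qed
qed

lemma card_code_times_card_symp_dual:
  assumes C: "H23_code (2 * m) C"
  shows "card C * card (symp_dual m C) = 36 ^ m * card (ter_component (2 * m) C)"
proof -
  let ?A = "bin_component (2 * m) C" and ?B = "ter_component (2 * m) C"
  have A: "?A \<subseteq> carrier_vec (2 * m)" and B: "?B \<subseteq> carrier_vec (2 * m)"
    by (auto simp: bin_component_def ter_component_def)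
  \<comment> \<open>The sign count is applied to an additive subgroup; in characteristic 2 this
    amounts to zero and closure under sums.\<close>
  have "map_vec a_times (0\<^sub>v (2 * m)) = 0\<^sub>v (2 * m)"
    by (rule eq_vecI) (auto simp: a_times_simps)
  then have zero: "0\<^sub>v (2 * m) \<in> ?A"
    using C by (simp add: bin_component_def H23_code_def)
  have closed: "x + y \<in> ?A" if "x \<in> ?A" "y \<in> ?A" for x y
  proof -
    have "map_vec a_times (x + y) = map_vec a_times x + map_vec a_times y"
      by (rule eq_vecI) (use that in \<open>auto simp: bin_component_def a_times_def plus_H23_def\<close>)
    then show ?thesis using that C by (simp add: bin_component_def H23_code_def)
  qed
  have "card C = card ?A * card ?B"
    using H23_code_decomp[OF C] card_a_plus_b[OF A B] by simp
  \<comment> \<open>The ternary part of a dual vector is free, which leaves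
    \<open>3 ^ (2 * m) = 9 ^ m\<close> choices.\<close>
  moreover have "card (symp_dual m C) = card (symp_dual_F2 m ?A) * 9 ^ m"
    unfolding symp_dual_decomp[OF C]
    by (subst card_a_plus_b[where n = "2 * m"])
      (auto simp: symp_dual_F2_def card_carrier_vec power_mult)
  ultimately have "card C * card (symp_dual m C) =
      (card ?A * card (symp_dual_F2 m ?A)) * 9 ^ m * card ?B"
    by simp
  also have "\<dots> = (4 * 9) ^ m * card ?B"
    using card_symp_dual_F2[OF A zero] closed by (simp only: power_mult_distrib)
  finally show ?thesis by simp
qed

theorem corollary4p3:
  fixes m :: nat and C :: "H23 vec set"
  assumes "1 \<le> m"
    and "H23_code (2 * m) C"
  shows "symp_nice m C \<longleftrightarrow> ter_component (2 * m) C = {0\<^sub>v (2 * m)}"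
proof -
  have "map_vec b_times (0\<^sub>v (2 * m)) = 0\<^sub>v (2 * m)"
    by (rule eq_vecI) (auto simp: b_times_simps)
  then have "0\<^sub>v (2 * m) \<in> ter_component (2 * m) C"
    using assms(2) by (simp add: ter_component_def H23_code_def)
  \<comment> \<open>Cancelling \<open>36 ^ m\<close> below turns niceness into the ternary component
    having one element, which can only be zero.\<close>
  then have "card (ter_component (2 * m) C) = 1 \<longleftrightarrow> ter_component (2 * m) C = {0\<^sub>v (2 * m)}"
    by (auto simp: card_1_singleton_iff)
  then show ?thesis
    by (simp add: symp_nice_def card_code_times_card_symp_dual[OF assms(2)])
qed

end
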